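(* Let $H$ be an acyclic monoid. Then $H$ is atomic if and only if $H$ has a generating set (as a monoid) each of whose elements satisfies the ACCP.
   Context: Monoids are multiplicatively written and not necessarily commutative; a unit is an invertible element. A monoid $H$ is acyclic if $uxv \ne x$ for all $u, v, x \in H$ unless $u$ and $v$ are both units. An atom of $H$ is a non-unit that does not factor as a product of two non-units. The monoid $H$ is atomic if each non-unit of $H$ is a product of (finitely many) atoms. An element $x \in H$ satisfies the ACCP if there is no infinite sequence $x_1, x_2, \ldots$ in $H$ with $x_1 = x$ and $H x_i H \subsetneq H x_{i+1} H$ for each $i \ge 1$, where $HyH := \{uyv : u, v \in H\}$. *)

theory Defs
  imports "HOL-Algebra.Group" "HOL.Hull"
begin

locale acyclic_monoid = monoid +
  assumes acyclic:
    "\<lbrakk>u \<in> carrier G; v \<in> carrier G; x \<in> carrier G; u \<otimes> x \<otimes> v = x\<rbrakk>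
      \<Longrightarrow> u \<in> Units G \<and> v \<in> Units G"

(* Stated for an arbitrary monoid. The library predicate irreducible of HOL-Algebra.Divisibility is
   phrased through one-sided proper divisors and is tailored to commutative monoids. *)
definition monoid_atom :: "('a, 'b) monoid_scheme \<Rightarrow> 'a \<Rightarrow> bool" where
  "monoid_atom H a \<longleftrightarrow> a \<in> carrier H \<and> a \<notin> Units H \<and>
    \<not> (\<exists>b \<in> carrier H - Units H. \<exists>c \<in> carrier H - Units H. a = b \<otimes>\<^bsub>H\<^esub> c)"

(* The empty list has product the identity, which is a unit, so the list as below of a
   non-unit is automatically nonempty. *)
definition atomic_monoid :: "('a, 'b) monoid_scheme \<Rightarrow> bool" where
  "atomic_monoid H \<longleftrightarrow>
    (\<forall>x \<in> carrier H - Units H.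
      \<exists>as. (\<forall>a \<in> set as. monoid_atom H a) \<and> x = foldr (\<otimes>\<^bsub>H\<^esub>) as \<one>\<^bsub>H\<^esub>)"

definition two_sided_principal_ideal :: "('a, 'b) monoid_scheme \<Rightarrow> 'a \<Rightarrow> 'a set" where
  "two_sided_principal_ideal H y =
    {u \<otimes>\<^bsub>H\<^esub> y \<otimes>\<^bsub>H\<^esub> v | u v. u \<in> carrier H \<and> v \<in> carrier H}"

(* Sequences are indexed from 0 instead of from 1. *)
definition satisfies_ACCP :: "('a, 'b) monoid_scheme \<Rightarrow> 'a \<Rightarrow> bool" where
  "satisfies_ACCP H x \<longleftrightarrow>
    \<not> (\<exists>f :: nat \<Rightarrow> 'a. range f \<subseteq> carrier H \<and> f 0 = x \<and>
        (\<forall>i. two_sided_principal_ideal H (f i) \<subset> two_sided_principal_ideal H (f (Suc i))))"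

(* The hull is the intersection of all submonoids of H that contain A. *)
definition generates_monoid :: "('a, 'b) monoid_scheme \<Rightarrow> 'a set \<Rightarrow> bool" where
  "generates_monoid H A \<longleftrightarrow>
    A \<subseteq> carrier H \<and> (\<lambda>M. submonoid M H) hull A = carrier H"

end

theory Submission
  imports Defs
begin

text \<open>
  Acyclicity makes factors of units units, and it makes every factorization of an element into two
  non-units strictly enlarge the two-sided principal ideal of either factor. So whenever a
  non-unit that is not a product of atoms is split into two non-units, at least one of them is again
  not a product of atoms and generates a strictly larger ideal; iterating this contradicts the ACCP.
  Hence a non-unit satisfying the ACCP is a product of atoms.

  To pass from generators to all elements, it is factorability rather than the ACCP that is carried
  along products: the units together with the products of atoms form a submonoid, because a unit
  can be absorbed into a neighbouring atom. A generating set whose elements satisfy the ACCP lies in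
  this submonoid, which is therefore the whole monoid.

  Conversely, units and atoms generate an atomic monoid, and both satisfy the ACCP: a unit
  generates the whole monoid as an ideal, and the only principal ideal strictly above that of an
  atom is the whole monoid.
\<close>

section \<open>Principal ideals and the ACCP\<close>

lemma (in monoid) mem_two_sided_principal_ideal:
  assumes "y \<in> carrier G"
  shows "y \<in> two_sided_principal_ideal G y"
proof -
  have "y = \<one> \<otimes> y \<otimes> \<one>" using assms by simp
  then show ?thesis unfolding two_sided_principal_ideal_def by blast
qed

lemma (in monoid) two_sided_principal_ideal_mono:
  assumes "u \<in> carrier G" "v \<in> carrier G" "y \<in> carrier G"
  shows "two_sided_principal_ideal G (u \<otimes> y \<otimes> v) \<subseteq> two_sided_principal_ideal G y"
proof
  fix z assume "z \<in> two_sided_principal_ideal G (u \<otimes> y \<otimes> v)"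
  then obtain s t where st: "s \<in> carrier G" "t \<in> carrier G" "z = s \<otimes> (u \<otimes> y \<otimes> v) \<otimes> t"
    unfolding two_sided_principal_ideal_def by blast
  then have "z = (s \<otimes> u) \<otimes> y \<otimes> (v \<otimes> t)" using assms by (simp add: m_assoc)
  then show "z \<in> two_sided_principal_ideal G y"
    unfolding two_sided_principal_ideal_def using st assms by blast
qed

lemma (in monoid) two_sided_principal_ideal_Unit:
  assumes "x \<in> Units G"
  shows "two_sided_principal_ideal G x = carrier G"
proof
  show "two_sided_principal_ideal G x \<subseteq> carrier G"
    unfolding two_sided_principal_ideal_def using assms by auto
  show "carrier G \<subseteq> two_sided_principal_ideal G x"
  proof
    fix z assume z: "z \<in> carrier G"
    then have "z = (z \<otimes> inv x) \<otimes> x \<otimes> \<one>"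
      using assms Units_closed[OF assms] by (simp add: m_assoc)
    then show "z \<in> two_sided_principal_ideal G x"
      unfolding two_sided_principal_ideal_def using z assms by blast
  qed
qed

lemma (in monoid) two_sided_principal_ideal_associated:
  assumes "u \<in> Units G" "v \<in> Units G" "y \<in> carrier G"
  shows "two_sided_principal_ideal G (u \<otimes> y \<otimes> v) = two_sided_principal_ideal G y"
proof
  show "two_sided_principal_ideal G (u \<otimes> y \<otimes> v) \<subseteq> two_sided_principal_ideal G y"
    using assms by (simp add: Units_closed two_sided_principal_ideal_mono)
  have "inv u \<otimes> (u \<otimes> y \<otimes> v) \<otimes> inv v = (inv u \<otimes> u) \<otimes> y \<otimes> (v \<otimes> inv v)"
    using assms by (simp add: Units_closed m_assoc del: Units_l_inv Units_r_inv)
  then have "inv u \<otimes> (u \<otimes> y \<otimes> v) \<otimes> inv v = y" using assms by simp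
  then show "two_sided_principal_ideal G y \<subseteq> two_sided_principal_ideal G (u \<otimes> y \<otimes> v)"
    using two_sided_principal_ideal_mono[of "inv u" "inv v" "u \<otimes> y \<otimes> v"] assms
    by (simp add: Units_closed)
qed

lemma (in monoid) satisfies_ACCP_Unit:
  assumes "x \<in> Units G"
  shows "satisfies_ACCP G x"
  unfolding satisfies_ACCP_def
proof
  assume "\<exists>f :: nat \<Rightarrow> 'a. range f \<subseteq> carrier G \<and> f 0 = x \<and>
    (\<forall>i. two_sided_principal_ideal G (f i) \<subset> two_sided_principal_ideal G (f (Suc i)))"
  then obtain f :: "nat \<Rightarrow> 'a" where f: "range f \<subseteq> carrier G" "f 0 = x"
    "two_sided_principal_ideal G (f 0) \<subset> two_sided_principal_ideal G (f (Suc 0))" by blast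
  have "two_sided_principal_ideal G (f (Suc 0)) \<subseteq> carrier G"
    unfolding two_sided_principal_ideal_def using f(1) by auto
  with f(2,3) two_sided_principal_ideal_Unit[OF assms] show False by auto
qed

text \<open>
  The ACCP as an induction principle: a property that passes to an element from the elements
  generating strictly larger ideals holds at every element with the ACCP, since a counterexample
  would start an infinite ascending chain of counterexamples.
\<close>
lemma satisfies_ACCP_induct:
  assumes "satisfies_ACCP H x" "x \<in> carrier H"
    and step: "\<And>y. y \<in> carrier H \<Longrightarrow>
      (\<And>z. z \<in> carrier H \<Longrightarrow>
        two_sided_principal_ideal H y \<subset> two_sided_principal_ideal H z \<Longrightarrow> P z) \<Longrightarrow> P y"
  shows "P x"
proof (rule ccontr)
  assume "\<not> P x"
  let ?R = "\<lambda>y z. two_sided_principal_ideal H y \<subset> two_sided_principal_ideal H z"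
  \<comment> \<open>Only the initial term is prescribed, so the starting condition enters as the case n = 0.\<close>
  have "\<exists>f. \<forall>n. (f n \<in> carrier H \<and> \<not> P (f n) \<and> (n = 0 \<longrightarrow> f n = x)) \<and> ?R (f n) (f (Suc n))"
  proof (rule dependent_nat_choice)
    show "\<exists>y. y \<in> carrier H \<and> \<not> P y \<and> ((0::nat) = 0 \<longrightarrow> y = x)"
      using assms(2) \<open>\<not> P x\<close> by blast
  next
    fix y and n :: nat
    assume "y \<in> carrier H \<and> \<not> P y \<and> (n = 0 \<longrightarrow> y = x)"
    then show "\<exists>z. (z \<in> carrier H \<and> \<not> P z \<and> (Suc n = 0 \<longrightarrow> z = x)) \<and> ?R y z"
      using step by blast
  qed
  then obtain f where f:
    "\<forall>n. (f n \<in> carrier H \<and> \<not> P (f n) \<and> (n = 0 \<longrightarrow> f n = x)) \<and> ?R (f n) (f (Suc n))" ..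
  have "range f \<subseteq> carrier H" using f by auto
  moreover have "f 0 = x" using f by simp
  moreover have "\<forall>n. ?R (f n) (f (Suc n))" using f by simp
  ultimately have "range f \<subseteq> carrier H \<and> f 0 = x \<and> (\<forall>n. ?R (f n) (f (Suc n)))" by simp
  with assms(1) show False unfolding satisfies_ACCP_def by blast
qed

section \<open>Factors in acyclic monoids\<close>

lemma (in acyclic_monoid) Units_factors:
  assumes "b \<in> carrier G" "c \<in> carrier G" "b \<otimes> c \<in> Units G"
  shows "b \<in> Units G" "c \<in> Units G"
proof -
  let ?w = "inv (b \<otimes> c)"
  have w: "?w \<in> carrier G" using assms(3) by simp
  have "b \<otimes> \<one> \<otimes> (c \<otimes> ?w) = (b \<otimes> c) \<otimes> ?w"
    using assms(1,2) w by (simp add: m_assoc del: Units_r_inv)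
  then show "b \<in> Units G"
    using acyclic[of b "c \<otimes> ?w" \<one>] assms w by simp
  have "(?w \<otimes> b) \<otimes> \<one> \<otimes> c = ?w \<otimes> (b \<otimes> c)"
    using assms(1,2) w by (simp add: m_assoc del: Units_l_inv)
  then show "c \<in> Units G"
    using acyclic[of "?w \<otimes> b" c \<one>] assms w by simp
qed

text \<open>
  If an element generated the same ideal as its factor, the factor could be written as a
  two-sided multiple of itself with the cofactor among the multipliers; acyclicity then makes the
  cofactor divide a unit.
\<close>
lemma (in acyclic_monoid) two_sided_principal_ideal_factors:
  assumes b: "b \<in> carrier G - Units G" and c: "c \<in> carrier G - Units G"
  shows "two_sided_principal_ideal G (b \<otimes> c) \<subset> two_sided_principal_ideal G b"
    and "two_sided_principal_ideal G (b \<otimes> c) \<subset> two_sided_principal_ideal G c"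
proof -
  have "two_sided_principal_ideal G (b \<otimes> c) \<subseteq> two_sided_principal_ideal G b"
    using two_sided_principal_ideal_mono[of \<one> c b] b c by simp
  moreover have "b \<notin> two_sided_principal_ideal G (b \<otimes> c)"
  proof
    assume "b \<in> two_sided_principal_ideal G (b \<otimes> c)"
    then obtain u v where uv: "u \<in> carrier G" "v \<in> carrier G" "b = u \<otimes> (b \<otimes> c) \<otimes> v"
      unfolding two_sided_principal_ideal_def by blast
    then have "u \<otimes> b \<otimes> (c \<otimes> v) = b" using b c by (simp add: m_assoc)
    then have "c \<otimes> v \<in> Units G" using acyclic[of u "c \<otimes> v" b] uv(1,2) b c by simp
    then show False using Units_factors(1)[of c v] uv(2) c by simp
  qed
  ultimately show "two_sided_principal_ideal G (b \<otimes> c) \<subset> two_sided_principal_ideal G b"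
    using mem_two_sided_principal_ideal[of b] b by blast
  have "two_sided_principal_ideal G (b \<otimes> c) \<subseteq> two_sided_principal_ideal G c"
    using two_sided_principal_ideal_mono[of b \<one> c] b c by simp
  moreover have "c \<notin> two_sided_principal_ideal G (b \<otimes> c)"
  proof
    assume "c \<in> two_sided_principal_ideal G (b \<otimes> c)"
    then obtain u v where uv: "u \<in> carrier G" "v \<in> carrier G" "c = u \<otimes> (b \<otimes> c) \<otimes> v"
      unfolding two_sided_principal_ideal_def by blast
    then have "(u \<otimes> b) \<otimes> c \<otimes> v = c" using b c by (simp add: m_assoc)
    then have "u \<otimes> b \<in> Units G" using acyclic[of "u \<otimes> b" v c] uv(1,2) b c by simp
    then show False using Units_factors(2)[of u b] uv(1) b by simp
  qed
  ultimately show "two_sided_principal_ideal G (b \<otimes> c) \<subset> two_sided_principal_ideal G c"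
    using mem_two_sided_principal_ideal[of c] c by blast
qed

section \<open>Atoms\<close>

lemma (in monoid) monoid_atom_factors:
  assumes "monoid_atom G (b \<otimes> c)" "b \<in> carrier G" "c \<in> carrier G"
  shows "b \<in> Units G \<or> c \<in> Units G"
  using assms unfolding monoid_atom_def by blast

lemma (in acyclic_monoid) Unit_mult_monoid_atom:
  assumes u: "u \<in> Units G" and a: "monoid_atom G a"
  shows "monoid_atom G (u \<otimes> a)"
proof -
  have ac: "a \<in> carrier G" "a \<notin> Units G" using a by (auto simp: monoid_atom_def)
  have "u \<otimes> a \<notin> Units G" using Units_factors(2)[of u a] u ac by auto
  moreover have "b \<in> Units G \<or> c \<in> Units G"
    if bc: "b \<in> carrier G" "c \<in> carrier G" "u \<otimes> a = b \<otimes> c" for b c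
  proof -
    have "a = inv u \<otimes> (u \<otimes> a)" using u ac by (simp add: Units_closed m_assoc[symmetric])
    also have "\<dots> = (inv u \<otimes> b) \<otimes> c" using u bc by (simp add: Units_closed m_assoc)
    finally have "monoid_atom G ((inv u \<otimes> b) \<otimes> c)" using a by simp
    then have "inv u \<otimes> b \<in> Units G \<or> c \<in> Units G"
      using monoid_atom_factors[of "inv u \<otimes> b" c] u bc by simp
    then show ?thesis using Units_factors(2)[of "inv u" b] u bc by auto
  qed
  ultimately show ?thesis using u ac unfolding monoid_atom_def by auto
qed

lemma (in acyclic_monoid) monoid_atom_mult_Unit:
  assumes u: "u \<in> Units G" and a: "monoid_atom G a"
  shows "monoid_atom G (a \<otimes> u)"
proof -
  have ac: "a \<in> carrier G" "a \<notin> Units G" using a by (auto simp: monoid_atom_def)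
  have "a \<otimes> u \<notin> Units G" using Units_factors(1)[of a u] u ac by auto
  moreover have "b \<in> Units G \<or> c \<in> Units G"
    if bc: "b \<in> carrier G" "c \<in> carrier G" "a \<otimes> u = b \<otimes> c" for b c
  proof -
    have "a = (a \<otimes> u) \<otimes> inv u" using u ac by (simp add: Units_closed m_assoc)
    also have "\<dots> = b \<otimes> (c \<otimes> inv u)" using u bc by (simp add: Units_closed m_assoc)
    finally have "monoid_atom G (b \<otimes> (c \<otimes> inv u))" using a by simp
    then have "b \<in> Units G \<or> c \<otimes> inv u \<in> Units G"
      using monoid_atom_factors[of b "c \<otimes> inv u"] u bc by simp
    then show ?thesis using Units_factors(1)[of c "inv u"] u bc by auto
  qed
  ultimately show ?thesis using u ac unfolding monoid_atom_def by auto
qed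

text \<open>
  In a factorization of an atom through a non-unit, both outer factors must be units, so that the
  ideal does not grow. Hence a chain starting at an atom reaches a unit after one step.
\<close>
lemma (in acyclic_monoid) satisfies_ACCP_monoid_atom:
  assumes a: "monoid_atom G a"
  shows "satisfies_ACCP G a"
  unfolding satisfies_ACCP_def
proof
  assume "\<exists>f :: nat \<Rightarrow> 'a. range f \<subseteq> carrier G \<and> f 0 = a \<and>
    (\<forall>i. two_sided_principal_ideal G (f i) \<subset> two_sided_principal_ideal G (f (Suc i)))"
  then obtain f :: "nat \<Rightarrow> 'a" where f: "range f \<subseteq> carrier G" "f 0 = a"
    and asc: "\<And>i. two_sided_principal_ideal G (f i) \<subset> two_sided_principal_ideal G (f (Suc i))"
    by blast
  let ?y = "f (Suc 0)"
  have y: "?y \<in> carrier G" using f(1) by blast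
  have ac: "a \<in> carrier G" using a by (simp add: monoid_atom_def)
  have "a \<in> two_sided_principal_ideal G ?y"
    using mem_two_sided_principal_ideal[OF ac] asc[of 0] f(2) by auto
  then obtain u v where uv: "u \<in> carrier G" "v \<in> carrier G" "a = u \<otimes> ?y \<otimes> v"
    unfolding two_sided_principal_ideal_def by blast
  have "?y \<in> Units G"
  proof (rule ccontr)
    assume ny: "?y \<notin> Units G"
    have "u \<otimes> ?y \<notin> Units G" using Units_factors(2)[of u ?y] uv(1) y ny by auto
    then have v: "v \<in> Units G"
      using monoid_atom_factors[of "u \<otimes> ?y" v] a uv y by simp
    have "?y \<otimes> v \<notin> Units G" using Units_factors(1)[of ?y v] uv(2) y ny by auto
    then have u: "u \<in> Units G"
      using monoid_atom_factors[of u "?y \<otimes> v"] a uv y by (simp add: m_assoc)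
    show False
      using two_sided_principal_ideal_associated[OF u v y] asc[of 0] f(2) uv(3) by simp
  qed
  \<comment> \<open>The shifted sequence would be an infinite ascending chain starting at a unit.\<close>
  then have "satisfies_ACCP G ?y" by (rule satisfies_ACCP_Unit)
  moreover have "range (\<lambda>i. f (Suc i)) \<subseteq> carrier G" using f(1) by blast
  ultimately show False
    unfolding satisfies_ACCP_def using asc by (auto dest!: spec[of _ "\<lambda>i. f (Suc i)"])
qed

section \<open>The submonoid of factorable elements\<close>

text \<open>
  Units are added to the products of atoms so that the set is closed under multiplication and so
  that atomicity means that it is everything.
\<close>
definition factorable :: "('a, 'b) monoid_scheme \<Rightarrow> 'a set" where
  "factorable H = Units H \<union>
    {foldr (\<otimes>\<^bsub>H\<^esub>) as \<one>\<^bsub>H\<^esub> | as. \<forall>a \<in> set as. monoid_atom H a}"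

lemma (in monoid) foldr_mult_closed:
  assumes "set as \<subseteq> carrier G"
  shows "foldr (\<otimes>) as \<one> \<in> carrier G"
  using assms by (induction as) auto

lemma (in monoid) foldr_mult_append:
  assumes "set as \<subseteq> carrier G" "set bs \<subseteq> carrier G"
  shows "foldr (\<otimes>) (as @ bs) \<one> = foldr (\<otimes>) as \<one> \<otimes> foldr (\<otimes>) bs \<one>"
  using assms(1)
proof (induction as)
  case Nil
  then show ?case using foldr_mult_closed[OF assms(2)] by (simp del: foldr_append)
next
  case (Cons a as)
  then show ?case
    using foldr_mult_closed[OF assms(2)] foldr_mult_closed[of as]
    by (simp add: m_assoc del: foldr_append)
qed

text \<open>
  Closure under multiplication is where units matter: a unit next to a nonempty product of atoms
  is absorbed into the first or the last atom.
\<close>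
lemma (in acyclic_monoid) submonoid_factorable:
  "submonoid (factorable G) G"
proof
  have atoms_closed: "set as \<subseteq> carrier G" if "\<forall>a \<in> set as. monoid_atom G a" for as
    using that by (auto simp: monoid_atom_def)
  show "factorable G \<subseteq> carrier G"
    using foldr_mult_closed[OF atoms_closed] by (auto simp: factorable_def)
  show "\<one> \<in> factorable G" by (simp add: factorable_def)
  fix x y assume x: "x \<in> factorable G" and y: "y \<in> factorable G"
  have foldr_factorable: "foldr (\<otimes>) as \<one> \<in> factorable G"
    if "\<forall>a \<in> set as. monoid_atom G a" for as
    using that by (auto simp: factorable_def)
  have Unit_left: "u \<otimes> foldr (\<otimes>) as \<one> \<in> factorable G"
    if u: "u \<in> Units G" and as: "\<forall>a \<in> set as. monoid_atom G a" for u as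
  proof (cases as)
    case Nil
    then show ?thesis using u by (simp add: factorable_def)
  next
    case (Cons a as')
    have "u \<otimes> foldr (\<otimes>) as \<one> = foldr (\<otimes>) ((u \<otimes> a) # as') \<one>"
      using Units_closed[OF u] Cons atoms_closed[OF as] foldr_mult_closed[of as']
      by (simp add: m_assoc)
    moreover have "\<forall>b \<in> set ((u \<otimes> a) # as'). monoid_atom G b"
      using as Cons Unit_mult_monoid_atom[OF u] by simp
    ultimately show ?thesis using foldr_factorable by metis
  qed
  have Unit_right: "foldr (\<otimes>) as \<one> \<otimes> u \<in> factorable G"
    if u: "u \<in> Units G" and as: "\<forall>a \<in> set as. monoid_atom G a" for u as
  proof (cases as rule: rev_cases)
    case Nil
    then show ?thesis using u by (simp add: factorable_def)
  next
    case (snoc as' a)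
    have cl: "set as' \<subseteq> carrier G" "a \<in> carrier G" using atoms_closed[OF as] snoc by auto
    have "foldr (\<otimes>) as \<one> \<otimes> u = foldr (\<otimes>) (as' @ [a \<otimes> u]) \<one>"
      using Units_closed[OF u] snoc cl foldr_mult_closed[OF cl(1)] foldr_mult_append[OF cl(1), of "[a]"]
        foldr_mult_append[OF cl(1), of "[a \<otimes> u]"]
      by (simp add: m_assoc del: foldr_append)
    moreover have "\<forall>b \<in> set (as' @ [a \<otimes> u]). monoid_atom G b"
      using as snoc monoid_atom_mult_Unit[OF u] by simp
    ultimately show ?thesis using foldr_factorable by metis
  qed
  have append: "foldr (\<otimes>) as \<one> \<otimes> foldr (\<otimes>) bs \<one> \<in> factorable G"
    if as: "\<forall>a \<in> set as. monoid_atom G a" and bs: "\<forall>b \<in> set bs. monoid_atom G b" for as bs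
  proof -
    have "\<forall>c \<in> set (as @ bs). monoid_atom G c" using as bs by auto
    then have "foldr (\<otimes>) (as @ bs) \<one> \<in> factorable G" by (rule foldr_factorable)
    then show ?thesis
      using foldr_mult_append[OF atoms_closed[OF as] atoms_closed[OF bs]] by metis
  qed
  have cases: "z \<in> Units G \<or> (\<exists>as. (\<forall>a \<in> set as. monoid_atom G a) \<and> z = foldr (\<otimes>) as \<one>)"
    if "z \<in> factorable G" for z
    using that by (auto simp: factorable_def)
  have "x \<otimes> y \<in> factorable G" if "x \<in> Units G" "y \<in> Units G"
    using that by (simp add: factorable_def)
  then show "x \<otimes> y \<in> factorable G"
    using cases[OF x] cases[OF y] Unit_left Unit_right append by metis
qed

text \<open>
  An element that is neither a unit nor an atom splits into two non-units, whose ideals are both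
  strictly larger, so induction along the ACCP applies to both factors.
\<close>
lemma (in acyclic_monoid) satisfies_ACCP_imp_factorable:
  assumes "satisfies_ACCP G x" "x \<in> carrier G"
  shows "x \<in> factorable G"
proof (rule satisfies_ACCP_induct[OF assms])
  fix y assume y: "y \<in> carrier G"
    and IH: "\<And>z. z \<in> carrier G \<Longrightarrow>
      two_sided_principal_ideal G y \<subset> two_sided_principal_ideal G z \<Longrightarrow> z \<in> factorable G"
  consider "y \<in> Units G" | "monoid_atom G y"
    | b c where "b \<in> carrier G - Units G" "c \<in> carrier G - Units G" "y = b \<otimes> c"
    using y unfolding monoid_atom_def by blast
  then show "y \<in> factorable G"
  proof cases
    case 1
    then show ?thesis by (simp add: factorable_def)
  next
    case 2
    then have "y = foldr (\<otimes>) [y] \<one> \<and> (\<forall>a \<in> set [y]. monoid_atom G a)" using y by simp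
    then show ?thesis unfolding factorable_def by blast
  next
    case (3 b c)
    then have "b \<in> factorable G" "c \<in> factorable G"
      using IH two_sided_principal_ideal_factors[of b c] by auto
    then show ?thesis using submonoid.m_closed[OF submonoid_factorable] 3(3) by simp
  qed
qed

section \<open>Atomicity through generating sets\<close>

lemma (in monoid) atomic_monoid_iff_factorable:
  "atomic_monoid G \<longleftrightarrow> carrier G \<subseteq> factorable G"
proof -
  have "x \<in> factorable G \<longleftrightarrow>
      x \<in> Units G \<or> (\<exists>as. (\<forall>a \<in> set as. monoid_atom G a) \<and> x = foldr (\<otimes>) as \<one>)" for x
    by (auto simp: factorable_def)
  moreover have "(\<forall>x \<in> carrier G - Units G. Q x) \<longleftrightarrow>
      (\<forall>x \<in> carrier G. x \<in> Units G \<or> Q x)" for Q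
    by blast
  ultimately show ?thesis unfolding atomic_monoid_def subset_eq by simp
qed

lemma (in monoid) atomic_monoid_generated_by_Units_atoms:
  assumes "atomic_monoid G"
  shows "generates_monoid G (Units G \<union> {a. monoid_atom G a})" (is "generates_monoid G ?A")
  unfolding generates_monoid_def
proof
  show A: "?A \<subseteq> carrier G" by (auto simp: monoid_atom_def)
  have "submonoid (carrier G) G" by unfold_locales auto
  then have "(\<lambda>M. submonoid M G) hull ?A \<subseteq> carrier G" using A by (intro hull_minimal)
  moreover have "carrier G \<subseteq> M" if M: "submonoid M G" "?A \<subseteq> M" for M
  proof
    have foldr_M: "foldr (\<otimes>) as \<one> \<in> M" if "\<forall>a \<in> set as. monoid_atom G a" for as
      using that M(2)
      by (induction as) (auto intro: submonoid.one_closed[OF M(1)] submonoid.m_closed[OF M(1)])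
    fix x assume "x \<in> carrier G"
    then have "x \<in> factorable G" using assms atomic_monoid_iff_factorable by blast
    then show "x \<in> M" using foldr_M M(2) by (auto simp: factorable_def)
  qed
  ultimately show "(\<lambda>M. submonoid M G) hull ?A = carrier G" unfolding hull_def by blast
qed

theorem corollary2p6:
  fixes H :: "('a, 'b) monoid_scheme"
  assumes "acyclic_monoid H"
  shows "atomic_monoid H \<longleftrightarrow>
    (\<exists>A. generates_monoid H A \<and> (\<forall>x \<in> A. satisfies_ACCP H x))"
proof -
  interpret acyclic_monoid H by (rule assms)
  show ?thesis
  proof
    assume "atomic_monoid H"
    then have "generates_monoid H (Units H \<union> {a. monoid_atom H a})"
      by (rule atomic_monoid_generated_by_Units_atoms)
    then show "\<exists>A. generates_monoid H A \<and> (\<forall>x \<in> A. satisfies_ACCP H x)"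
      using satisfies_ACCP_Unit satisfies_ACCP_monoid_atom by blast
  next
    assume "\<exists>A. generates_monoid H A \<and> (\<forall>x \<in> A. satisfies_ACCP H x)"
    then obtain A where A: "A \<subseteq> carrier H" "(\<lambda>M. submonoid M H) hull A = carrier H"
      and ACCP: "\<And>x. x \<in> A \<Longrightarrow> satisfies_ACCP H x"
      unfolding generates_monoid_def by blast
    have "A \<subseteq> factorable H" using satisfies_ACCP_imp_factorable ACCP A(1) by blast
    then have "(\<lambda>M. submonoid M H) hull A \<subseteq> factorable H"
      using submonoid_factorable by (intro hull_minimal)
    then show "atomic_monoid H" using A(2) atomic_monoid_iff_factorable by simp
  qed
qed

end
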